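(* For any binary string $s$ of length $1$ or $2$ other than $s=00$, there exist a strongly connected directed graph $D$, a parallel chip-firing game on $D$, and a vertex $v$ of $D$ such that $v$ has $s$ as its atomic firing sequence.
   Context: A directed graph $D=(V,E)$ is a finite set of vertices $V$ with a set $E$ of ordered pairs of vertices; $(u,v)\in E$ is an edge directed from $u$ to $v$, and the out-degree $\deg^+ v$ is the number of edges directed from $v$. It is strongly connected if there is a directed path in both directions between every pair of vertices. A parallel chip-firing game on $D$ starts with a finite nonnegative integer number of chips on each vertex. In each round, simultaneously, every vertex $v$ having at least $\deg^+ v$ chips fires, sending one chip along each of its outgoing edges; all other vertices wait. The game has period $T$ if $T$ is the smallest positive integer for which there is a round $t_0$ such that every vertex has the same number of chips in round $t$ as in round $t+T$ for all $t\ge t_0$. The least such $t_0$ is relabelled round $0$. Let $F_t(v)=1$ if $v$ fires in round $t$ and $F_t(v)=0$ otherwise. The atomic firing sequence of $v$ is the length-$T$ binary string $F_0(v)F_1(v)\cdots F_{T-1}(v)$, where $T$ is the period of the game. *)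

theory Defs
  imports "Graph_Theory.Graph_Theory"
begin

(* Directed graphs (V, E) with E a set of ordered pairs of vertices are the
   pair digraphs of Graph_Theory; the values of a chip configuration outside
   the vertex set are irrelevant. *)

definition fires :: "'a pair_pre_digraph \<Rightarrow> ('a \<Rightarrow> nat) \<Rightarrow> 'a \<Rightarrow> bool" where
  "fires D c v \<longleftrightarrow> out_degree (with_proj D) v \<le> c v"

(* The subtraction never truncates, since a firing vertex has at least
   out-degree many chips. *)
definition chip_step :: "'a pair_pre_digraph \<Rightarrow> ('a \<Rightarrow> nat) \<Rightarrow> 'a \<Rightarrow> nat" where
  "chip_step D c v =
     c v - (if fires D c v then out_degree (with_proj D) v else 0)
       + card {u. (u, v) \<in> parcs D \<and> fires D c u}"

definition chips :: "'a pair_pre_digraph \<Rightarrow> ('a \<Rightarrow> nat) \<Rightarrow> nat \<Rightarrow> 'a \<Rightarrow> nat" where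
  "chips D c t = (chip_step D ^^ t) c"

definition repeats_from :: "'a pair_pre_digraph \<Rightarrow> ('a \<Rightarrow> nat) \<Rightarrow> nat \<Rightarrow> nat \<Rightarrow> bool" where
  "repeats_from D c T t0 \<longleftrightarrow>
     (\<forall>t\<ge>t0. \<forall>v\<in>pverts D. chips D c t v = chips D c (t + T) v)"

(* On a finite digraph the number of chips is conserved, so the game is
   eventually periodic and both minima below are attained. *)
definition game_period :: "'a pair_pre_digraph \<Rightarrow> ('a \<Rightarrow> nat) \<Rightarrow> nat" where
  "game_period D c = (LEAST T. 0 < T \<and> (\<exists>t0. repeats_from D c T t0))"

definition period_start :: "'a pair_pre_digraph \<Rightarrow> ('a \<Rightarrow> nat) \<Rightarrow> nat" where
  "period_start D c = (LEAST t0. repeats_from D c (game_period D c) t0)"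

(* Binary strings are bool lists, True standing for the digit 1. *)
definition atomic_firing_sequence ::
    "'a pair_pre_digraph \<Rightarrow> ('a \<Rightarrow> nat) \<Rightarrow> 'a \<Rightarrow> bool list" where
  "atomic_firing_sequence D c v =
     map (\<lambda>i. fires D (chips D c (period_start D c + i)) v) [0..<game_period D c]"

end

theory Submission
  imports Defs
begin

text \<open>The two-cycle with one chip on each vertex is fixed with every vertex firing. The other
  strings all occur on the graph with edges \<open>0 \<rightarrow> 1\<close>, \<open>1 \<rightarrow> 0\<close>, \<open>1 \<rightarrow> 2\<close>, \<open>2 \<rightarrow> 0\<close>. Over a
  period its firing counts are multiples of the kernel vector \<open>(2, 1, 1)\<close> of the Laplacian, so in
  a game of period 2 in which vertices \<open>1\<close> and \<open>2\<close> fire alternately, vertex \<open>0\<close> fires in every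
  round although the game is not constant.\<close>

lemma chips_Suc: "chips D c (Suc t) = chip_step D (chips D c t)"
  by (simp add: chips_def)

lemma chips_0 [simp]: "chips D c 0 = c"
  by (simp add: chips_def)

lemma atomic_firing_sequence_fixed:
  assumes "chip_step D c = c"
  shows "atomic_firing_sequence D c v = [fires D c v]"
proof -
  have const: "chips D c t = c" for t
    by (induction t) (simp_all add: chips_Suc assms)
  have "repeats_from D c 1 0"
    by (simp add: repeats_from_def const)
  then have "game_period D c = 1"
    unfolding game_period_def by (intro Least_equality) auto
  \<comment> \<open>The configuration is \<open>c\<close> in every round, so the value of
    \<open>period_start\<close> does not matter.\<close>
  then show ?thesis
    by (simp add: atomic_firing_sequence_def const)
qed

text \<open>The witness \<open>w\<close> rules out period 1. It must be a vertex of \<open>D\<close>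
  because \<open>repeats_from\<close> compares chips on \<open>pverts D\<close> only.\<close>

lemma atomic_firing_sequence_alternating:
  assumes step: "chip_step D c = c'" "chip_step D c' = c"
    and w: "w \<in> pverts D" "c w \<noteq> c' w"
  shows "atomic_firing_sequence D c v = [fires D c v, fires D c' v]"
proof -
  have chips_eq: "chips D c t = (if even t then c else c')" for t
    by (induction t) (simp_all add: chips_Suc step)
  have repeats2: "repeats_from D c 2 0"
    by (simp add: repeats_from_def chips_eq)
  \<comment> \<open>Consecutive rounds always show \<open>c\<close> and \<open>c'\<close> in some
    order, so \<open>w\<close> changes its number of chips however late the round.\<close>
  have not_repeats1: "\<not> repeats_from D c 1 t0" for t0
  proof
    assume "repeats_from D c 1 t0"
    then have "chips D c t0 w = chips D c (t0 + 1) w"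
      using w unfolding repeats_from_def by blast
    with w show False
      by (simp add: chips_eq split: if_splits)
  qed
  have period: "game_period D c = 2"
    unfolding game_period_def
  proof (rule Least_equality)
    show "0 < (2::nat) \<and> (\<exists>t0. repeats_from D c 2 t0)"
      using repeats2 by auto
  next
    fix T :: nat
    assume "0 < T \<and> (\<exists>t0. repeats_from D c T t0)"
    then have "0 < T" "T \<noteq> 1"
      using not_repeats1 by auto
    then show "2 \<le> T" by simp
  qed
  \<comment> \<open>This fixes the order of the two digits: the digit for \<open>c\<close> comes
    first.\<close>
  have "period_start D c = 0"
    using repeats2 by (simp add: period_start_def period)
  then show ?thesis
    by (simp add: atomic_firing_sequence_def period chips_eq numeral_2_eq_2)
qed

lemma out_degree_with_proj:
  "out_degree (with_proj D) v = card {e \<in> parcs D. fst e = v}"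
  by (simp add: out_degree_def out_arcs_def)

definition two_cycle :: "nat pair_pre_digraph" where
  "two_cycle = \<lparr>pverts = {0, 1}, parcs = {(0, 1), (1, 0)}\<rparr>"

definition chord_cycle :: "nat pair_pre_digraph" where
  "chord_cycle = \<lparr>pverts = {0, 1, 2}, parcs = {(0, 1), (1, 0), (1, 2), (2, 0)}\<rparr>"

lemma pair_fin_digraph_two_cycle: "pair_fin_digraph two_cycle"
  by unfold_locales (auto simp: two_cycle_def)

lemma pair_fin_digraph_chord_cycle: "pair_fin_digraph chord_cycle"
  by unfold_locales (auto simp: chord_cycle_def)

text \<open>Any two vertices are joined by a walk through \<open>h\<close>, so only paths to and
  from \<open>h\<close> need to be exhibited.\<close>

lemma strongly_connected_hub:
  assumes "pair_fin_digraph D" and "h \<in> pverts D"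
    and from_hub: "\<And>v. v \<in> pverts D \<Longrightarrow> v \<noteq> h \<Longrightarrow> h \<rightarrow>\<^sup>*\<^bsub>with_proj D\<^esub> v"
    and to_hub: "\<And>v. v \<in> pverts D \<Longrightarrow> v \<noteq> h \<Longrightarrow> v \<rightarrow>\<^sup>*\<^bsub>with_proj D\<^esub> h"
  shows "strongly_connected (with_proj D)"
proof -
  interpret pair_fin_digraph D by fact
  have hub: "h \<rightarrow>\<^sup>*\<^bsub>with_proj D\<^esub> h"
    using assms(2) by simp
  show ?thesis
  proof (rule strongly_connectedI)
    show "verts (with_proj D) \<noteq> {}"
      using assms(2) by auto
  next
    fix u v
    assume "u \<in> verts (with_proj D)" "v \<in> verts (with_proj D)"
    then have "u \<rightarrow>\<^sup>*\<^bsub>with_proj D\<^esub> h" "h \<rightarrow>\<^sup>*\<^bsub>with_proj D\<^esub> v"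
      using from_hub to_hub hub by (cases "u = h"; cases "v = h"; simp)+
    then show "u \<rightarrow>\<^sup>*\<^bsub>with_proj D\<^esub> v"
      by (rule reachable_trans)
  qed
qed

lemma strongly_connected_two_cycle: "strongly_connected (with_proj two_cycle)"
proof -
  interpret pair_fin_digraph two_cycle by (rule pair_fin_digraph_two_cycle)
  have "0 \<rightarrow>\<^sup>*\<^bsub>with_proj two_cycle\<^esub> 1" "1 \<rightarrow>\<^sup>*\<^bsub>with_proj two_cycle\<^esub> 0"
    by (rule reachable_adjI; simp add: two_cycle_def)+
  then show ?thesis
    by (intro strongly_connected_hub[of _ 0] pair_fin_digraph_two_cycle)
      (auto simp: two_cycle_def)
qed

lemma strongly_connected_chord_cycle: "strongly_connected (with_proj chord_cycle)"
proof -
  interpret pair_fin_digraph chord_cycle by (rule pair_fin_digraph_chord_cycle)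
  have adj: "0 \<rightarrow>\<^sup>*\<^bsub>with_proj chord_cycle\<^esub> 1" "1 \<rightarrow>\<^sup>*\<^bsub>with_proj chord_cycle\<^esub> 0"
    "1 \<rightarrow>\<^sup>*\<^bsub>with_proj chord_cycle\<^esub> 2" "2 \<rightarrow>\<^sup>*\<^bsub>with_proj chord_cycle\<^esub> 0"
    by (rule reachable_adjI; simp add: chord_cycle_def)+
  moreover have "0 \<rightarrow>\<^sup>*\<^bsub>with_proj chord_cycle\<^esub> 2"
    using adj(1,3) by (rule reachable_trans)
  ultimately show ?thesis
    by (intro strongly_connected_hub[of _ 0] pair_fin_digraph_chord_cycle)
      (auto simp: chord_cycle_def)
qed

text \<open>All natural numbers are covered because configurations are compared as functions. A
  number outside the graph has out-degree 0, so it counts as firing but loses nothing.\<close>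

lemma out_degree_two_cycle:
  "out_degree (with_proj two_cycle) v = (if v < 2 then 1 else 0)"
proof -
  have "{e \<in> parcs two_cycle. fst e = v} =
      (if v = 0 then {(0, 1)} else if v = 1 then {(1, 0)} else {})"
    by (auto simp: two_cycle_def)
  then show ?thesis
    by (simp add: out_degree_with_proj)
qed

lemma out_degree_chord_cycle:
  "out_degree (with_proj chord_cycle) v =
    (if v = 1 then 2 else if v = 0 \<or> v = 2 then 1 else 0)"
proof -
  have "{e \<in> parcs chord_cycle. fst e = v} =
      (if v = 0 then {(0, 1)} else if v = 1 then {(1, 0), (1, 2)}
       else if v = 2 then {(2, 0)} else {})"
    by (auto simp: chord_cycle_def)
  then show ?thesis
    by (simp add: out_degree_with_proj)
qed

text \<open>Both vertices fire, and each gets back from the other the one chip it sends.\<close>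

lemma chip_step_two_cycle:
  "chip_step two_cycle (\<lambda>v. if v < 2 then 1 else 0) = (\<lambda>v. if v < 2 then 1 else 0)"
proof
  fix v :: nat
  have "{u. (u, v) \<in> parcs two_cycle \<and> fires two_cycle (\<lambda>v. if v < 2 then 1 else 0) u} =
      (if v = 0 then {1} else if v = 1 then {0} else {})"
    by (simp add: fires_def out_degree_two_cycle) (auto simp: two_cycle_def)
  then show "chip_step two_cycle (\<lambda>v. if v < 2 then 1 else 0) v = (if v < 2 then 1 else 0)"
    by (simp add: chip_step_def fires_def out_degree_two_cycle)
qed

text \<open>Leaving \<open>P\<close> arbitrary lets one count of incoming chips serve every
  configuration on this graph.\<close>

lemma in_firing_chord_cycle:
  "card {u. (u, v) \<in> parcs chord_cycle \<and> P u} =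
    (if v = 0 then of_bool (P 1) + of_bool (P 2) else if v = 1 then of_bool (P 0)
     else if v = 2 then of_bool (P 1) else 0)"
proof -
  have "{u. (u, v) \<in> parcs chord_cycle \<and> P u} =
      (if v = 0 then (if P 1 then {1} else {}) \<union> (if P 2 then {2} else {})
       else if v = 1 then (if P 0 then {0} else {})
       else if v = 2 then (if P 1 then {1} else {}) else {})"
    by (auto simp: chord_cycle_def split: if_splits)
  then show ?thesis
    by simp
qed

text \<open>Chips (1, 2, 0): vertices 0 and 1 fire while 2 waits.\<close>

definition phase_a :: "nat \<Rightarrow> nat" where
  "phase_a v = (if v = 0 then 1 else if v = 1 then 2 else 0)"

text \<open>Chips (1, 1, 1): vertices 0 and 2 fire, while 1 waits because its out-degree is
  2.\<close>

definition phase_b :: "nat \<Rightarrow> nat" where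
  "phase_b v = (if v < 3 then 1 else 0)"

lemmas chord_cycle_simps =
  chip_step_def fires_def out_degree_chord_cycle in_firing_chord_cycle phase_a_def phase_b_def

lemma chip_step_phase_a: "chip_step chord_cycle phase_a = phase_b"
  by (rule ext) (auto simp: chord_cycle_simps)

lemma chip_step_phase_b: "chip_step chord_cycle phase_b = phase_a"
  by (rule ext) (auto simp: chord_cycle_simps)

text \<open>Every vertex of the graph has positive out-degree, so without chips none of them
  fires.\<close>

lemma chip_step_chord_cycle_empty: "chip_step chord_cycle (\<lambda>_. 0) = (\<lambda>_. 0)"
  by (rule ext) (auto simp: chord_cycle_simps)

lemma atomic_firing_sequence_phase_a:
  "atomic_firing_sequence chord_cycle phase_a v =
    [fires chord_cycle phase_a v, fires chord_cycle phase_b v]"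
proof (rule atomic_firing_sequence_alternating[OF chip_step_phase_a chip_step_phase_b])
  \<comment> \<open>Vertex 0 cannot be the witness: it holds one chip in both phases.\<close>
  show "1 \<in> pverts chord_cycle" "phase_a 1 \<noteq> phase_b 1"
    by (simp_all add: chord_cycle_def phase_a_def phase_b_def)
qed

theorem lemma4p2:
  fixes s :: "bool list"
  assumes "length s = 1 \<or> length s = 2"
    and "s \<noteq> [False, False]"
  shows "\<exists>(D :: nat pair_pre_digraph) (c :: nat \<Rightarrow> nat) v.
           pair_fin_digraph D \<and> strongly_connected (with_proj D) \<and>
           v \<in> pverts D \<and> atomic_firing_sequence D c v = s"
proof -
  have chord: ?thesis
    if "v \<in> pverts chord_cycle" "atomic_firing_sequence chord_cycle c v = s" for c v
    using that pair_fin_digraph_chord_cycle strongly_connected_chord_cycle by blast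
  have verts: "0 \<in> pverts chord_cycle" "1 \<in> pverts chord_cycle" "2 \<in> pverts chord_cycle"
    by (simp_all add: chord_cycle_def)
  consider "s = [True]" | "s = [False]" | "s = [True, True]" | "s = [True, False]"
    | "s = [False, True]"
    using assms by (auto simp: length_Suc_conv numeral_2_eq_2)
  then show ?thesis
  proof cases
    case 1
    have "atomic_firing_sequence two_cycle (\<lambda>v. if v < 2 then 1 else 0) 0 = s"
      using 1 atomic_firing_sequence_fixed[OF chip_step_two_cycle, of 0]
      by (simp add: fires_def out_degree_two_cycle)
    moreover have "0 \<in> pverts two_cycle"
      by (simp add: two_cycle_def)
    ultimately show ?thesis
      using pair_fin_digraph_two_cycle strongly_connected_two_cycle by blast
  next
    case 2
    then have "atomic_firing_sequence chord_cycle (\<lambda>_. 0) 0 = s"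
      using atomic_firing_sequence_fixed[OF chip_step_chord_cycle_empty, of 0]
      by (simp add: fires_def out_degree_chord_cycle)
    with verts(1) show ?thesis by (rule chord)
  next
    case 3
    then have "atomic_firing_sequence chord_cycle phase_a 0 = s"
      by (simp add: atomic_firing_sequence_phase_a chord_cycle_simps)
    with verts(1) show ?thesis by (rule chord)
  next
    case 4
    then have "atomic_firing_sequence chord_cycle phase_a 1 = s"
      by (simp add: atomic_firing_sequence_phase_a chord_cycle_simps)
    with verts(2) show ?thesis by (rule chord)
  next
    case 5
    then have "atomic_firing_sequence chord_cycle phase_a 2 = s"
      by (simp add: atomic_firing_sequence_phase_a chord_cycle_simps)
    with verts(3) show ?thesis by (rule chord)
  qed
qed

end
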